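(* Let $(X,\pi;M_X,I_X)$ and $(Y,\sigma;M_Y,I_Y)$ be impulsive semidynamical systems satisfying the standing assumptions. Let $x\in X$, $y\in Y$ and assume that $\tilde L_X^+(x)\neq\emptyset$. If $y$ is comparable with $x$ with respect to the set $\tilde L_X^+(x)$, then there is a continuous mapping $h:\tilde L_X^+(x)\to\tilde L_Y^+(y)$ such that $\mathcal L_{x,q}^{+\infty}\subset\mathcal L_{y,h(q)}^{+\infty}$ for all $q\in\tilde L_X^+(x)$ and $$h(\tilde\pi(q,t))=\tilde\sigma(h(q),t)\quad\text{for all } q\in\tilde L_X^+(x)\setminus M_X \text{ and } t\in\mathbb R_+.$$
   Context: Let $\mathbb R_+=[0,+\infty)$. A semidynamical system $(Z,\varrho)$ on a metric space $Z$ is a continuous map $\varrho:Z\times\mathbb R_+\to Z$ with $\varrho(z,0)=z$ and $\varrho(\varrho(z,t),s)=\varrho(z,t+s)$ for all $z\in Z$, $t,s\in\mathbb R_+$. For $z\in Z$, $t\ge 0$ put $F(z,t)=\{w\in Z:\varrho(w,t)=z\}$; for $D\subset Z$, $\Delta\subset[0,+\infty)$ put $F(D,\Delta)=\bigcup_{z\in D,\,t\in\Delta}F(z,t)$ (singletons are written without braces). A point $z$ is an initial point if $F(z,t)=\emptyset$ for all $t>0$. An impulsive semidynamical system (ISS) $(Z,\varrho;M,I)$ consists of a semidynamical system $(Z,\varrho)$, a nonempty closed set $M\subset Z$ such that for every $z\in M$ there is $\epsilon_z>0$ with $F(z,(0,\epsilon_z))\cap M=\emptyset$ and $\varrho(z,(0,\epsilon_z))\cap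 M=\emptyset$, and a continuous function $I:M\to Z$. Let $\phi(z)\in(0,+\infty]$ be the least $s>0$ with $\varrho(z,s)\in M$, and $\phi(z)=+\infty$ if no such $s$ exists. The impulsive trajectory $\tilde\varrho(z,\cdot)$ of $z$ is defined inductively: $z_0^+=z$, $t_0=0$; given $z_n^+$ and $t_n$, if $\phi(z_n^+)=+\infty$ then $\tilde\varrho(z,t)=\varrho(z_n^+,t-t_n)$ for all $t\ge t_n$; otherwise let $s_n=\phi(z_n^+)$, $t_{n+1}=t_n+s_n$, $\tilde\varrho(z,t)=\varrho(z_n^+,t-t_n)$ for $t_n\le t<t_{n+1}$, $z_{n+1}=\varrho(z_n^+,s_n)\in M$, $z_{n+1}^+=I(z_{n+1})$, and $\tilde\varrho(z,t_{n+1})=z_{n+1}^+$. Strong Tube Condition (STC): a point $z\in M$ satisfies STC if there are $\lambda>0$ and closed sets $S,L\subset Z$ with $z\in S$ such that $F(L,\lambda)=S$; $F(L,[0,2\lambda])$ is a neighborhood of $z$; $F(L,\mu)\cap F(L,\nu)=\emptyset$ for $0\le\mu<\nu\le 2\lambda$; and $S=M\cap F(L,[0,2\lambda])$. Standing assumptions on every ISS: no initial point of $(Z,\varrho)$ belongs to $M$ and every element of $M$ satisfies STC (consequently $\phi$ is continuous on $Z\setminus M$); $M\cap I(M)=\emptyset$; and $\tilde\varrho(z,t)$ is defined for all $t\ge 0$ and all $z\in Z$. Here $(X,\rho_X)$ and $(Y,\rho_Y)$ are metric spaces, and $\tilde\pi,\tilde\sigma$ denote the impulsive trajectories in $(X,\pi;M_X,I_X)$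 and $(Y,\sigma;M_Y,I_Y)$. The positive limit set $\tilde L_X^+(x)$ is the set of all $q\in X$ for which there is a sequence $\lambda_n\to+\infty$ in $\mathbb R_+$ with $\tilde\pi(x,\lambda_n)\to q$; $\tilde L_Y^+(y)$ is defined analogously with $\tilde\sigma$. For a system $(Z,\varrho;M,I)$, $z,p\in Z$ and $A\subset Z$: $\mathcal L_{z,p}^{+\infty}$ is the set of sequences $\{t_n\}_{n\in\mathbb N}\subset\mathbb R_+$ with $t_n\to+\infty$ and $\tilde\varrho(z,t_n)\to p$; $\mathcal L_z^{+\infty}(A)=\bigcup_{p\in A}\mathcal L_{z,p}^{+\infty}$; $\mathcal L_z^{+\infty}=\mathcal L_z^{+\infty}(Z)$. A point $y\in Y$ is comparable with $x\in X$ with respect to a set $A\subset X$ if $\mathcal L_x^{+\infty}(A)\subset\mathcal L_y^{+\infty}$. *)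

theory Defs
  imports "HOL-Analysis.Analysis"
begin

text \<open>
  Time is the half-line \<open>{0..}\<close> of the reals. All maps taking a time argument are total functions on
  \<open>real\<close>; their values at negative times are irrelevant and never used.
\<close>

locale semidynamical_system =
  fixes \<rho> :: "'z::metric_space \<Rightarrow> real \<Rightarrow> 'z"
  assumes cont: "continuous_on (UNIV \<times> {0..}) (\<lambda>(z, t). \<rho> z t)"
    and at_zero: "\<rho> z 0 = z"
    and semigroup: "0 \<le> t \<Longrightarrow> 0 \<le> s \<Longrightarrow> \<rho> (\<rho> z t) s = \<rho> z (t + s)"

definition past :: "('z \<Rightarrow> real \<Rightarrow> 'z) \<Rightarrow> 'z \<Rightarrow> real \<Rightarrow> 'z set" where
  "past \<rho> z t = {w. \<rho> w t = z}"

definition past_set :: "('z \<Rightarrow> real \<Rightarrow> 'z) \<Rightarrow> 'z set \<Rightarrow> real set \<Rightarrow> 'z set" where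
  "past_set \<rho> D \<Delta> = (\<Union>z\<in>D. \<Union>t\<in>\<Delta>. past \<rho> z t)"

definition initial_point :: "('z \<Rightarrow> real \<Rightarrow> 'z) \<Rightarrow> 'z \<Rightarrow> bool" where
  "initial_point \<rho> z \<longleftrightarrow> (\<forall>t>0. past \<rho> z t = {})"

locale impulsive_semidynamical_system = semidynamical_system \<rho>
  for \<rho> :: "'z::metric_space \<Rightarrow> real \<Rightarrow> 'z" +
  fixes M :: "'z set" and I :: "'z \<Rightarrow> 'z"
  assumes M_nonempty: "M \<noteq> {}"
    and M_closed: "closed M"
    and M_isolated: "z \<in> M \<Longrightarrow> \<exists>\<epsilon>>0. past_set \<rho> {z} {0<..<\<epsilon>} \<inter> M = {} \<and> \<rho> z ` {0<..<\<epsilon>} \<inter> M = {}"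
    and I_cont: "continuous_on M I"

text \<open>
  In an impulsive semidynamical system the minimum below exists whenever \<open>M\<close> is reached at a
  positive time, since \<open>M\<close> is closed and trajectories leave \<open>M\<close> immediately.
\<close>

definition hitting_time :: "('z \<Rightarrow> real \<Rightarrow> 'z) \<Rightarrow> 'z set \<Rightarrow> 'z \<Rightarrow> ereal" where
  "hitting_time \<rho> M z =
     (if \<exists>s>0. \<rho> z s \<in> M then ereal (LEAST s. 0 < s \<and> \<rho> z s \<in> M) else \<infinity>)"

text \<open>
  \<open>post_impulse\<close> and \<open>impulse_time\<close> are the sequences of points $z_n^+$ and times $t_n$. If the
  \<open>n\<close>-th point never reaches \<open>M\<close>, there are no further impulses; then $t_{n+1} = \infty$, and all
  later entries of both sequences are dummies.
\<close>

primrec post_impulse :: "('z \<Rightarrow> real \<Rightarrow> 'z) \<Rightarrow> 'z set \<Rightarrow> ('z \<Rightarrow> 'z) \<Rightarrow> 'z \<Rightarrow> nat \<Rightarrow> 'z" where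
  "post_impulse \<rho> M I z 0 = z"
| "post_impulse \<rho> M I z (Suc n) =
     (let w = post_impulse \<rho> M I z n in
      if hitting_time \<rho> M w = \<infinity> then w else I (\<rho> w (real_of_ereal (hitting_time \<rho> M w))))"

primrec impulse_time :: "('z \<Rightarrow> real \<Rightarrow> 'z) \<Rightarrow> 'z set \<Rightarrow> ('z \<Rightarrow> 'z) \<Rightarrow> 'z \<Rightarrow> nat \<Rightarrow> ereal" where
  "impulse_time \<rho> M I z 0 = 0"
| "impulse_time \<rho> M I z (Suc n) =
     impulse_time \<rho> M I z n + hitting_time \<rho> M (post_impulse \<rho> M I z n)"

definition in_phase :: "('z \<Rightarrow> real \<Rightarrow> 'z) \<Rightarrow> 'z set \<Rightarrow> ('z \<Rightarrow> 'z) \<Rightarrow> 'z \<Rightarrow> real \<Rightarrow> nat \<Rightarrow> bool" where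
  "in_phase \<rho> M I z t n \<longleftrightarrow>
     impulse_time \<rho> M I z n \<le> ereal t \<and> ereal t < impulse_time \<rho> M I z (Suc n)"

text \<open>
  In an impulsive semidynamical system each time \<open>t \<ge> 0\<close> lies in at most one phase, and in
  none exactly when it is not before an accumulation of
  infinitely many impulses. In that case the trajectory is undefined at \<open>t\<close>, and the value of
  \<open>impulsive_traj\<close> is meaningless.
\<close>

definition traj_defined_at :: "('z \<Rightarrow> real \<Rightarrow> 'z) \<Rightarrow> 'z set \<Rightarrow> ('z \<Rightarrow> 'z) \<Rightarrow> 'z \<Rightarrow> real \<Rightarrow> bool" where
  "traj_defined_at \<rho> M I z t \<longleftrightarrow> (\<exists>n. in_phase \<rho> M I z t n)"

definition impulsive_traj :: "('z \<Rightarrow> real \<Rightarrow> 'z) \<Rightarrow> 'z set \<Rightarrow> ('z \<Rightarrow> 'z) \<Rightarrow> 'z \<Rightarrow> real \<Rightarrow> 'z" where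
  "impulsive_traj \<rho> M I z t =
     (let n = (THE n. in_phase \<rho> M I z t n)
      in \<rho> (post_impulse \<rho> M I z n) (t - real_of_ereal (impulse_time \<rho> M I z n)))"

definition strong_tube_condition ::
    "('z::metric_space \<Rightarrow> real \<Rightarrow> 'z) \<Rightarrow> 'z set \<Rightarrow> 'z \<Rightarrow> bool" where
  "strong_tube_condition \<rho> M z \<longleftrightarrow>
     (\<exists>\<tau>>0. \<exists>S L. closed S \<and> closed L \<and> z \<in> S \<and>
        past_set \<rho> L {\<tau>} = S \<and>
        z \<in> interior (past_set \<rho> L {0..2*\<tau>}) \<and>
        (\<forall>\<mu> \<nu>. 0 \<le> \<mu> \<and> \<mu> < \<nu> \<and> \<nu> \<le> 2*\<tau> \<longrightarrow> past_set \<rho> L {\<mu>} \<inter> past_set \<rho> L {\<nu>} = {}) \<and>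
        S = M \<inter> past_set \<rho> L {0..2*\<tau>})"

locale standing_impulsive_system = impulsive_semidynamical_system \<rho> M I
  for \<rho> :: "'z::metric_space \<Rightarrow> real \<Rightarrow> 'z" and M :: "'z set" and I :: "'z \<Rightarrow> 'z" +
  assumes M_not_initial: "z \<in> M \<Longrightarrow> \<not> initial_point \<rho> z"
    and M_tube: "z \<in> M \<Longrightarrow> strong_tube_condition \<rho> M z"
    and M_disjoint_image: "M \<inter> I ` M = {}"
    and traj_defined: "0 \<le> t \<Longrightarrow> traj_defined_at \<rho> M I z t"

definition limit_set ::
    "('z::metric_space \<Rightarrow> real \<Rightarrow> 'z) \<Rightarrow> 'z set \<Rightarrow> ('z \<Rightarrow> 'z) \<Rightarrow> 'z \<Rightarrow> 'z set" where
  "limit_set \<rho> M I z =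
     {q. \<exists>t :: nat \<Rightarrow> real. (\<forall>n. 0 \<le> t n) \<and> filterlim t at_top sequentially \<and>
           (\<lambda>n. impulsive_traj \<rho> M I z (t n)) \<longlonglongrightarrow> q}"

definition limit_seqs_at ::
    "('z::metric_space \<Rightarrow> real \<Rightarrow> 'z) \<Rightarrow> 'z set \<Rightarrow> ('z \<Rightarrow> 'z) \<Rightarrow> 'z \<Rightarrow> 'z \<Rightarrow> (nat \<Rightarrow> real) set" where
  "limit_seqs_at \<rho> M I z p =
     {t. (\<forall>n. 0 \<le> t n) \<and> filterlim t at_top sequentially \<and>
         (\<lambda>n. impulsive_traj \<rho> M I z (t n)) \<longlonglongrightarrow> p}"

definition limit_seqs ::
    "('z::metric_space \<Rightarrow> real \<Rightarrow> 'z) \<Rightarrow> 'z set \<Rightarrow> ('z \<Rightarrow> 'z) \<Rightarrow> 'z \<Rightarrow> 'z set \<Rightarrow> (nat \<Rightarrow> real) set" where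
  "limit_seqs \<rho> M I z A = (\<Union>p\<in>A. limit_seqs_at \<rho> M I z p)"

text \<open>\<open>y\<close> in the second system is comparable with \<open>x\<close> in the first system, with respect to \<open>A\<close>.\<close>

definition comparable_wrt ::
    "('y::metric_space \<Rightarrow> real \<Rightarrow> 'y) \<Rightarrow> 'y set \<Rightarrow> ('y \<Rightarrow> 'y) \<Rightarrow> 'y \<Rightarrow>
     ('x::metric_space \<Rightarrow> real \<Rightarrow> 'x) \<Rightarrow> 'x set \<Rightarrow> ('x \<Rightarrow> 'x) \<Rightarrow> 'x \<Rightarrow> 'x set \<Rightarrow> bool" where
  "comparable_wrt \<sigma> M\<^sub>Y I\<^sub>Y y \<pi> M\<^sub>X I\<^sub>X x A \<longleftrightarrow>
     limit_seqs \<pi> M\<^sub>X I\<^sub>X x A \<subseteq> limit_seqs \<sigma> M\<^sub>Y I\<^sub>Y y UNIV"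

end

theory Submission imports Defs begin

text \<open>
  Interleaving two sequences of times shows that all sequences in $\mathcal L_{x,q}$ produce the same
  limit \<open>h q\<close> along the trajectory of \<open>y\<close>; continuity of \<open>h\<close> is a diagonal argument. If points
  $w_k \to z$ have hitting times converging to that of \<open>z\<close>, then their impulsive trajectories converge
  to that of \<open>z\<close> at every time which is not an impulse time of \<open>z\<close>, which gives the intertwining
  relation at all times that are impulse times of neither \<open>q\<close> nor \<open>h q\<close>, and then at all times by
  right continuity. Hitting times do converge at $q \notin M_X$, by the tube condition. At \<open>h q\<close> the only alternative is that
  \<open>h q\<close> lies in $M_Y$ and the hitting times tend to 0 along a subsequence; then the points just after
  \<open>q\<close> are mapped close to $I_Y(h\,q)$, so continuity of \<open>h\<close> gives $h\,q = I_Y(h\,q) \in M_Y \cap I_Y(M_Y)$,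
  which is impossible.
\<close>

section \<open>Continuity of the flow\<close>

context semidynamical_system
begin

lemma tendsto_flow:
  assumes "(w \<longlongrightarrow> z) F" "(s \<longlongrightarrow> t) F" "\<forall>\<^sub>F k in F. 0 \<le> s k" "0 \<le> t"
  shows "((\<lambda>k. \<rho> (w k) (s k)) \<longlongrightarrow> \<rho> z t) F"
  using continuous_on_tendsto_compose[OF cont tendsto_Pair[OF assms(1,2)]] assms(3,4)
  by simp

lemma flow_continuous_on: "continuous_on {0..} (\<rho> z)"
  unfolding continuous_on_def
proof
  fix t :: real assume "t \<in> {0..}"
  then show "(\<rho> z \<longlongrightarrow> \<rho> z t) (at t within {0..})"
    using tendsto_flow[of "\<lambda>_. z" z "at t within {0..}" "\<lambda>s. s" t]
    by (auto simp: eventually_at_filter)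
qed

end

section \<open>Hitting times of the impulsive set\<close>

context impulsive_semidynamical_system
begin

abbreviation "hit \<equiv> hitting_time \<rho> M"
abbreviation "post \<equiv> post_impulse \<rho> M I"
abbreviation "itime \<equiv> impulse_time \<rho> M I"
abbreviation "phase \<equiv> in_phase \<rho> M I"
abbreviation "traj \<equiv> impulsive_traj \<rho> M I"

text \<open>On \<open>M\<close> this is the isolation axiom; off \<open>M\<close> it follows from
  closedness of \<open>M\<close> and continuity. It bounds the positive visiting times of each orbit
  away from 0.\<close>

lemma flow_avoids_M_initially: "\<exists>\<epsilon>>0. \<forall>s. 0 < s \<and> s < \<epsilon> \<longrightarrow> \<rho> z s \<notin> M"
proof (cases "z \<in> M")
  case True
  then show ?thesis using M_isolated[OF True] by fastforce
next
  case False
  have "((\<lambda>s. \<rho> z s) \<longlongrightarrow> \<rho> z 0) (at_right 0)"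
    by (rule tendsto_flow) (auto simp: eventually_at_right_less eventually_at_filter)
  then have "\<forall>\<^sub>F s in at_right 0. \<rho> z s \<in> - M"
    using False M_closed at_zero by (intro topological_tendstoD) auto
  then show ?thesis
    by (auto simp: eventually_at_right_field)
qed

text \<open>The positive visiting times are the visiting times in \<open>{\<epsilon>..}\<close>,
  hence form a closed set that contains its infimum. So the \<open>LEAST\<close> over the reals is a
  genuine minimum.\<close>

lemma hitting_time_attained:
  assumes "0 < s" "\<rho> z s \<in> M"
  obtains r where "hit z = ereal r" "0 < r" "r \<le> s" "\<rho> z r \<in> M"
proof -
  obtain \<epsilon> where e: "\<epsilon> > 0" "\<And>s. 0 < s \<Longrightarrow> s < \<epsilon> \<Longrightarrow> \<rho> z s \<notin> M"
    using flow_avoids_M_initially[of z] by blast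
  define A where "A = {s. 0 < s \<and> \<rho> z s \<in> M}"
  have A: "A = {\<epsilon>..} \<inter> \<rho> z -` M" unfolding A_def using e by force
  have "closed A"
    unfolding A using e(1) M_closed
    by (intro continuous_closed_preimage continuous_on_subset[OF flow_continuous_on]) auto
  moreover have "s \<in> A" using assms by (simp add: A_def)
  moreover have bdd: "bdd_below A" by (auto simp: A_def intro!: bdd_belowI[of _ 0])
  ultimately have m: "Inf A \<in> A" by (intro closed_contains_Inf) auto
  have le: "Inf A \<le> t" if "t \<in> A" for t using that bdd by (rule cInf_lower)
  have "(LEAST s. 0 < s \<and> \<rho> z s \<in> M) = Inf A"
    using m le by (intro Least_equality) (auto simp: A_def)
  then have "hit z = ereal (Inf A)" using assms by (auto simp: hitting_time_def)
  then show ?thesis using that m le[OF \<open>s \<in> A\<close>] by (auto simp: A_def)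
qed

lemma hitting_time_le: "0 < s \<Longrightarrow> \<rho> z s \<in> M \<Longrightarrow> hit z \<le> ereal s"
  by (metis hitting_time_attained ereal_less_eq(3))

lemma hitting_time_cases:
  obtains (infinite) "hit z = \<infinity>" | (finite) r where "hit z = ereal r" "0 < r" "\<rho> z r \<in> M"
  by (metis hitting_time_attained hitting_time_def)

lemma hitting_time_pos: "0 < hit z"
  by (rule hitting_time_cases[of z]) auto

text \<open>No visit to \<open>M\<close> is lost before time \<open>s\<close>, so the remaining
  visits are only shifted. The form as a sum also covers infinite hitting times.\<close>

lemma hitting_time_flow:
  assumes s: "0 \<le> s" "ereal s < hit z"
  shows "hit (\<rho> z s) + ereal s = hit z"
proof (rule antisym)
  show "hit (\<rho> z s) + ereal s \<le> hit z"
  proof (cases rule: hitting_time_cases[of z])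
    case (finite r)
    then have "0 < r - s" "\<rho> (\<rho> z s) (r - s) \<in> M" using s semigroup[of s "r - s" z] by auto
    from hitting_time_le[OF this] show ?thesis using finite by (cases "hit (\<rho> z s)") auto
  qed simp
  show "hit z \<le> hit (\<rho> z s) + ereal s"
  proof (cases rule: hitting_time_cases[of "\<rho> z s"])
    case (finite r)
    then have "0 < r + s" "\<rho> z (r + s) \<in> M" using s semigroup[of s r z] by (auto simp: add.commute)
    from hitting_time_le[OF this] show ?thesis using finite by simp
  qed simp
qed

section \<open>Impulse sequences, phases and the semigroup law\<close>

lemma post_impulse_add: "post z (n + m) = post (post z n) m"
  by (induction m) (auto simp: Let_def)

lemma impulse_time_add: "itime z (n + m) = itime z n + itime (post z n) m"
  by (induction m) (auto simp: post_impulse_add add.assoc)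

lemma impulse_time_nonneg: "0 \<le> itime z n"
  using add_nonneg_nonneg[OF _ less_imp_le[OF hitting_time_pos]] by (induction n) auto

lemma impulse_time_mono: "n \<le> m \<Longrightarrow> itime z n \<le> itime z m"
  using impulse_time_add[of z n "m - n"] impulse_time_nonneg[of "post z n" "m - n"]
  by (metis add.right_neutral add_left_mono le_add_diff_inverse)

text \<open>For \<open>n < m\<close> one would get
  \<open>t < itime z (Suc n) \<le> itime z m \<le> t\<close>. Uniqueness gives meaning to the
  \<open>THE\<close> in \<open>impulsive_traj\<close>.\<close>

lemma in_phase_unique:
  assumes "phase z t n" "phase z t m"
  shows "n = m"
proof -
  have "False" if "phase z t n" "phase z t m" "n < m" for n m
    using that impulse_time_mono[of "Suc n" m z] unfolding in_phase_def by (meson Suc_leI leD order_trans)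
  then show ?thesis using assms by (meson linorder_neqE_nat)
qed

text \<open>The definite description is unfolded only here; later arguments exhibit a phase and
  apply this rule.\<close>

lemma impulsive_traj_in_phase:
  assumes "phase z t n"
  obtains a where "itime z n = ereal a" "0 \<le> a" "a \<le> t" "ereal (t - a) < hit (post z n)"
    "traj z t = \<rho> (post z n) (t - a)"
proof -
  obtain a where a: "itime z n = ereal a" "0 \<le> a" "a \<le> t"
    using assms impulse_time_nonneg[of z n] unfolding in_phase_def
    by (cases "itime z n") auto
  have "(THE n. phase z t n) = n" using assms in_phase_unique by blast
  then have "traj z t = \<rho> (post z n) (t - a)"
    unfolding impulsive_traj_def using a by simp
  moreover have "ereal (t - a) < hit (post z n)"
    using assms a unfolding in_phase_def by (cases "hit (post z n)") auto
  ultimately show ?thesis using that a by blast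
qed

lemma in_phase_0: "0 \<le> t \<Longrightarrow> ereal t < hit z \<Longrightarrow> phase z t 0"
  by (simp add: in_phase_def)

lemma impulsive_traj_before_hit:
  "0 \<le> t \<Longrightarrow> ereal t < hit z \<Longrightarrow> traj z t = \<rho> z t"
  using impulsive_traj_in_phase[OF in_phase_0]
  by (metis diff_zero impulse_time.simps(1) post_impulse.simps(1) ereal.inject zero_ereal_def)

lemma impulsive_traj_at_hit:
  assumes "hit z = ereal r"
  shows "traj z r = I (\<rho> z r)"
proof -
  \<comment> \<open>Phases contain their left endpoint, so the hitting time already belongs to phase
    1, which has positive length.\<close>
  have "phase z r 1"
    using assms hitting_time_pos[of "I (\<rho> z r)"]
    by (cases "hit (I (\<rho> z r))") (auto simp: in_phase_def Let_def)
  then show ?thesis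
    by (rule impulsive_traj_in_phase) (use assms at_zero in auto)
qed

text \<open>The restriction to finite impulse times excludes the dummy values of \<open>post_impulse\<close>.\<close>

lemma impulses_of_flow:
  assumes a: "0 \<le> a" "ereal a < hit z"
  shows "itime (\<rho> z a) (Suc m) + ereal a = itime z (Suc m) \<and>
    (itime z (Suc m) < \<infinity> \<longrightarrow> post (\<rho> z a) (Suc m) = post z (Suc m))"
proof (induction m)
  \<comment> \<open>Indices start at 1: both sequences of times begin with 0, so the offset
    \<open>a\<close> appears only from the first impulse on.\<close>
  case 0
  have h: "hit (\<rho> z a) + ereal a = hit z" using hitting_time_flow[OF a] .
  show ?case
  proof (cases rule: hitting_time_cases[of "\<rho> z a"])
    case infinite
    then show ?thesis using h by simp
  next
    case (finite r)
    moreover have "\<rho> (\<rho> z a) r = \<rho> z (r + a)" using a finite semigroup[of a r z] by (simp add: add.commute)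
    ultimately show ?thesis using h by (simp add: Let_def flip: h)
  qed
next
  case (Suc m)
  define U W where "U = itime (\<rho> z a) (Suc m)" and "W = itime z (Suc m)"
  define P Q where "P = post (\<rho> z a) (Suc m)" and "Q = post z (Suc m)"
  have IH: "U + ereal a = W" "W < \<infinity> \<Longrightarrow> P = Q"
    using Suc unfolding U_def W_def P_def Q_def by blast+
  have sucs: "itime (\<rho> z a) (Suc (Suc m)) = U + hit P" "itime z (Suc (Suc m)) = W + hit Q"
    "post (\<rho> z a) (Suc (Suc m)) = (if hit P = \<infinity> then P else I (\<rho> P (real_of_ereal (hit P))))"
    "post z (Suc (Suc m)) = (if hit Q = \<infinity> then Q else I (\<rho> Q (real_of_ereal (hit Q))))"
    unfolding U_def W_def P_def Q_def by (simp_all only: impulse_time.simps(2) post_impulse.simps(2) Let_def)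
  show ?case
  proof (cases "W = \<infinity>")
    case True
    then have "U = \<infinity>" using IH(1) by (cases U) auto
    with True show ?thesis unfolding sucs by simp
  next
    case False
    then have "P = Q" using IH(2) by simp
    moreover have "U + hit Q + ereal a = W + hit Q" using IH(1) by (metis add.assoc add.commute)
    ultimately show ?thesis unfolding sucs by simp
  qed
qed

text \<open>The point \<open>traj z t\<close> lies on the flow orbit of \<open>post z n\<close>
  before the next impulse, so its later impulses are those of \<open>z\<close>: its phase
  \<open>m\<close> is phase \<open>n + m\<close> of \<open>z\<close>.\<close>

lemma impulsive_traj_add:
  assumes "phase z t n" "phase (traj z t) s m"
  shows "traj z (t + s) = traj (traj z t) s"
proof -
  obtain a where a: "itime z n = ereal a" "0 \<le> a" "a \<le> t" "ereal (t - a) < hit (post z n)"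
    "traj z t = \<rho> (post z n) (t - a)"
    using assms(1) by (rule impulsive_traj_in_phase)
  define w u where "w = post z n" and "u = traj z t"
  have u: "u = \<rho> w (t - a)" using a u_def w_def by simp
  obtain b where b: "itime u m = ereal b" "0 \<le> b" "b \<le> s" "ereal (s - b) < hit (post u m)"
    "traj u s = \<rho> (post u m) (s - b)"
    using assms(2) unfolding u_def by (rule impulsive_traj_in_phase)
  have step: "itime u (Suc k) + ereal t = itime z (n + Suc k)" for k
  proof -
    have "itime z (n + Suc k) = ereal a + itime w (Suc k)"
      using a(1) impulse_time_add[of z n "Suc k"] by (simp add: w_def)
    also have "\<dots> = ereal a + (itime u (Suc k) + ereal (t - a))"
      using impulses_of_flow[of "t - a" w k] a u w_def by simp
    finally show ?thesis
      by (cases "itime u (Suc k)") (auto simp del: impulse_time.simps(2))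
  qed
  have up: "ereal (t + s) < itime z (Suc (n + m))"
  proof -
    have "ereal s < itime u (Suc m)" using assms(2) by (simp add: in_phase_def u_def)
    then show ?thesis using step[of m] by (cases "itime u (Suc m)"; cases "itime z (n + Suc m)") (auto simp del: impulse_time.simps(2))
  qed
  show ?thesis
  \<comment> \<open>For \<open>m = 0\<close> no impulse intervenes and the semigroup law of the flow
    suffices, although the two starting points may differ. For positive \<open>m\<close> the last
    impulse is the same on both sides, and so is the point after it.\<close>
  proof (cases m)
    case 0
    then have "b = 0" using b by (simp add: zero_ereal_def)
    have "phase z (t + s) n" using up a b 0 by (auto simp: in_phase_def)
    then have "traj z (t + s) = \<rho> w (t + s - a)"
      by (rule impulsive_traj_in_phase) (use a w_def in auto)
    then show ?thesis
      using b a \<open>b = 0\<close> 0 semigroup[of "t - a" s w] by (simp add: u[symmetric] flip: u_def) (simp add: u algebra_simps)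
  next
    case (Suc k)
    have it: "itime z (n + m) = ereal (b + t)" using step[of k] b Suc by simp
    have "itime w (Suc k) < \<infinity>"
      using it a(1) impulse_time_add[of z n m] Suc by (cases "itime w (Suc k)") (auto simp: w_def)
    then have "post u m = post w m" using impulses_of_flow[of "t - a" w k] a u w_def Suc by simp
    then have p: "post z (n + m) = post u m" using post_impulse_add w_def by simp
    have "phase z (t + s) (n + m)" using up it b by (simp add: in_phase_def)
    then have "traj z (t + s) = \<rho> (post z (n + m)) (t + s - (b + t))"
      by (rule impulsive_traj_in_phase) (use it in auto)
    then show ?thesis using p b by (simp add: algebra_simps flip: u_def)
  qed
qed

section \<open>Semicontinuity of the hitting time\<close>

text \<open>Bounded hitting times of a subsequence accumulate at a time \<open>s'\<close> when
  \<open>z\<close> visits \<open>M\<close>. If \<open>s'\<close> is positive, this contradicts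
  \<open>a < hit z\<close>; if it is 0, then \<open>z\<close> lies in \<open>M\<close>, and the
  assumed lower bound \<open>\<delta>\<close> is violated.\<close>

lemma hitting_time_lower_semicontinuous:
  fixes w :: "nat \<Rightarrow> 'z"
  assumes w: "w \<longlonglongrightarrow> z" and M: "z \<in> M \<Longrightarrow> \<exists>\<delta>>0. \<forall>\<^sub>F k in sequentially. ereal \<delta> \<le> hit (w k)"
    and a: "a < hit z"
  shows "\<forall>\<^sub>F k in sequentially. a < hit (w k)"
proof (rule ccontr)
  assume "\<not> ?thesis"
  then obtain r :: "nat \<Rightarrow> nat" where r: "strict_mono r" "\<And>k. hit (w (r k)) \<le> a"
    using not_eventually_sequentiallyD by (metis not_less)
  obtain b where b: "a = ereal b"
    using a r(2)[of 0] hitting_time_pos[of "w (r 0)"] by (cases a) auto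
  have "\<exists>s. hit (w (r k)) = ereal s \<and> 0 < s \<and> s \<le> b \<and> \<rho> (w (r k)) s \<in> M" for k
    using r(2)[of k] b by (cases rule: hitting_time_cases[of "w (r k)"]) auto
  then obtain s where s: "\<And>k. hit (w (r k)) = ereal (s k)" "\<And>k. 0 < s k" "\<And>k. s k \<le> b"
    "\<And>k. \<rho> (w (r k)) (s k) \<in> M" by metis
  have "\<forall>k. s k \<in> {0..b}" using s by (simp add: less_imp_le)
  then obtain s' j where s': "s' \<in> {0..b}" and j: "strict_mono j" "(\<lambda>k. s (j k)) \<longlonglongrightarrow> s'"
    using seq_compactE[OF compact_imp_seq_compact[OF compact_Icc[of 0 b]], of s] unfolding o_def by blast
  have rj: "strict_mono (r \<circ> j)" using r j by (simp add: strict_mono_o)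
  have lim: "(\<lambda>k. \<rho> (w (r (j k))) (s (j k))) \<longlonglongrightarrow> \<rho> z s'"
    using LIMSEQ_subseq_LIMSEQ[OF w rj] j s' s(2) by (intro tendsto_flow) (auto simp: o_def intro!: always_eventually less_imp_le)
  have inM: "\<rho> z s' \<in> M"
    by (rule closed_sequentially[OF M_closed _ lim]) (use s in auto)
  have "s' \<noteq> 0"
  proof
    assume "s' = 0"
    then have "z \<in> M" using inM at_zero by simp
    then obtain \<delta> where d: "\<delta> > 0" "\<forall>\<^sub>F k in sequentially. ereal \<delta> \<le> hit (w k)" using M by blast
    have "\<forall>\<^sub>F k in sequentially. ereal \<delta> \<le> hit (w ((r \<circ> j) k))"
      using eventually_subseq[OF rj d(2)] .
    then have "\<forall>\<^sub>F k in sequentially. \<delta> \<le> s (j k)" using s(1) by simp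
    then have "\<delta> \<le> s'" using j(2) by (intro tendsto_lowerbound) auto
    then show False using d \<open>s' = 0\<close> by simp
  qed
  then have "hit z \<le> ereal s'" using s' inM by (intro hitting_time_le) auto
  then show False using a b s' by (metis atLeastAtMost_iff ereal_less_eq(3) leD order_trans)
qed

text \<open>
  A nearby trajectory enters the tube shortly before the hitting time of \<open>z\<close>; by disjointness of the
  slices its transit time to \<open>L\<close> is then close to \<open>\<tau> + u > \<tau>\<close>, so it still has to cross \<open>S\<close>.
\<close>

lemma hitting_time_upper_semicontinuous:
  fixes w :: "nat \<Rightarrow> 'z"
  assumes tube: "\<And>z. z \<in> M \<Longrightarrow> strong_tube_condition \<rho> M z"
    and w: "w \<longlonglongrightarrow> z" and a: "hit z < a"
  shows "\<forall>\<^sub>F k in sequentially. hit (w k) < a"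
proof (rule ccontr)
  assume "\<not> ?thesis"
  then have nev: "\<not> (\<forall>\<^sub>F k in sequentially. hit (w k) < a)" .
  obtain s where s: "hit z = ereal s" "0 < s" "\<rho> z s \<in> M"
    using a by (cases rule: hitting_time_cases[of z]) auto
  obtain \<tau> S L where T: "\<tau> > 0" "closed L" "\<rho> z s \<in> S" "past_set \<rho> L {\<tau>} = S"
    "\<rho> z s \<in> interior (past_set \<rho> L {0..2*\<tau>})"
    "\<forall>\<mu> \<nu>. 0 \<le> \<mu> \<and> \<mu> < \<nu> \<and> \<nu> \<le> 2*\<tau> \<longrightarrow> past_set \<rho> L {\<mu>} \<inter> past_set \<rho> L {\<nu>} = {}"
    "S = M \<inter> past_set \<rho> L {0..2*\<tau>}"
    using tube[OF s(3)] unfolding strong_tube_condition_def by (elim exE conjE) (rule that)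
  define N where "N = interior (past_set \<rho> L {0..2*\<tau>})"
  have "((\<lambda>u. \<rho> z (s - u)) \<longlongrightarrow> \<rho> z (s - 0)) (at_right 0)"
    using s(2) by (intro tendsto_flow tendsto_intros)
      (auto simp: eventually_at_right_field intro!: exI[of _ s])
  then have "\<forall>\<^sub>F u in at_right 0. \<rho> z (s - u) \<in> N"
    using T(5) by (intro topological_tendstoD) (auto simp: N_def)
  moreover have "\<forall>\<^sub>F u in at_right 0. 0 < u \<and> u < min s \<tau>"
    using s(2) T(1) unfolding eventually_at_right_field by (intro exI[of _ "min s \<tau>"]) simp
  ultimately have "\<forall>\<^sub>F u in at_right 0. \<rho> z (s - u) \<in> N \<and> 0 < u \<and> u < min s \<tau>"
    by (rule eventually_conj)
  \<comment> \<open>The bound \<open>u < \<tau>\<close> keeps \<open>\<tau> + u\<close> below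
    \<open>2*\<tau>\<close>, in the range where the slices of the tube are disjoint;
    \<open>u < s\<close> keeps the time \<open>s - u\<close> positive.\<close>
  then obtain u where u: "\<rho> z (s - u) \<in> N" "0 < u" "u < s" "u < \<tau>"
    using eventually_happens[of _ "at_right (0::real)"] by auto
  have "(\<lambda>k. \<rho> (w k) (s - u)) \<longlonglongrightarrow> \<rho> z (s - u)"
    using w u by (intro tendsto_flow) auto
  then have "\<forall>\<^sub>F k in sequentially. \<rho> (w k) (s - u) \<in> N"
    using u by (intro topological_tendstoD) (auto simp: N_def)
  then have "\<not> (\<forall>\<^sub>F k in sequentially. \<rho> (w k) (s - u) \<in> N \<longrightarrow> hit (w k) < a)"
    using nev eventually_mp[of "\<lambda>k. \<rho> (w k) (s - u) \<in> N" "\<lambda>k. hit (w k) < a" sequentially] by blast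
  then obtain r :: "nat \<Rightarrow> nat" where r: "strict_mono r"
    "\<And>k. \<rho> (w (r k)) (s - u) \<in> N" "\<And>k. a \<le> hit (w (r k))"
    using not_eventually_sequentiallyD[of "\<lambda>k. \<rho> (w k) (s - u) \<in> N \<longrightarrow> hit (w k) < a"]
    by (metis not_less)
  have "\<exists>v\<in>{0..2*\<tau>}. \<rho> (w (r k)) (s - u + v) \<in> L" for k
  proof -
    have "\<rho> (w (r k)) (s - u) \<in> past_set \<rho> L {0..2*\<tau>}"
      using r(2)[of k] interior_subset unfolding N_def by blast
    then show ?thesis using u semigroup[of "s - u"] by (fastforce simp: past_set_def past_def)
  qed
  then obtain v where v: "\<And>k. v k \<in> {0..2*\<tau>}" "\<And>k. \<rho> (w (r k)) (s - u + v k) \<in> L" by metis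
  then obtain v' j where v': "v' \<in> {0..2*\<tau>}" and j: "strict_mono j" "(\<lambda>k. v (j k)) \<longlonglongrightarrow> v'"
    using seq_compactE[OF compact_imp_seq_compact[OF compact_Icc[of 0 "2*\<tau>"]], of v] unfolding o_def by blast
  have rj: "strict_mono (r \<circ> j)" using r j by (simp add: strict_mono_o)
  have lim: "(\<lambda>k. \<rho> (w (r (j k))) (s - u + v (j k))) \<longlonglongrightarrow> \<rho> z (s - u + v')"
    using LIMSEQ_subseq_LIMSEQ[OF w rj] j v' v(1) u
    by (intro tendsto_flow tendsto_intros) (auto simp: o_def intro!: always_eventually add_nonneg_nonneg)
  have "\<rho> z (s - u + v') \<in> L"
    by (rule closed_sequentially[OF T(2) _ lim]) (use v in auto)
  then have 1: "\<rho> z (s - u) \<in> past_set \<rho> L {v'}"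
    using semigroup[of "s - u" v' z] u v' by (auto simp: past_set_def past_def)
  have "\<rho> (\<rho> z s) \<tau> \<in> L" using T(3,4) by (auto simp: past_set_def past_def)
  then have 2: "\<rho> z (s - u) \<in> past_set \<rho> L {\<tau> + u}"
    using semigroup[of "s - u" "\<tau> + u" z] semigroup[of s \<tau> z] u T(1) s
    by (auto simp: past_set_def past_def algebra_simps)
  have disj: False if "\<mu> < \<nu>" "0 \<le> \<mu>" "\<nu> \<le> 2*\<tau>" "\<rho> z (s - u) \<in> past_set \<rho> L {\<mu>}" "\<rho> z (s - u) \<in> past_set \<rho> L {\<nu>}" for \<mu> \<nu>
    using T(6) that by blast
  have v'_eq: "v' = \<tau> + u"
    using 1 2 v' u T(1) disj[of v' "\<tau> + u"] disj[of "\<tau> + u" v']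
    by (cases v' "\<tau> + u" rule: linorder_cases) auto
  \<comment> \<open>A point on its way to \<open>L\<close> with transit time exactly
    \<open>\<tau>\<close> lies in \<open>S\<close>, hence in \<open>M\<close>. The bound tends to
    \<open>s\<close>, because \<open>v' = \<tau> + u\<close>.\<close>
  have bound: "hit (w (r (j k))) \<le> ereal (s - u + v (j k) - \<tau>)" if "v (j k) > \<tau>" for k
  proof (rule hitting_time_le)
    show p: "0 < s - u + v (j k) - \<tau>" using that u by simp
    have "\<rho> (\<rho> (w (r (j k))) (s - u + v (j k) - \<tau>)) \<tau> \<in> L"
      using semigroup[of "s - u + v (j k) - \<tau>" \<tau>] p T(1) v(2)[of "j k"] by simp
    then have "\<rho> (w (r (j k))) (s - u + v (j k) - \<tau>) \<in> S"
      using T(4) by (auto simp: past_set_def past_def)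
    then show "\<rho> (w (r (j k))) (s - u + v (j k) - \<tau>) \<in> M" using T(7) by blast
  qed
  have "(\<lambda>k. ereal (s - u + v (j k) - \<tau>)) \<longlonglongrightarrow> ereal (s - u + v' - \<tau>)"
    using j by (intro tendsto_intros)
  then have "\<forall>\<^sub>F k in sequentially. ereal (s - u + v (j k) - \<tau>) < a"
    using a s(1) v'_eq by (intro order_tendstoD) auto
  moreover have "\<forall>\<^sub>F k in sequentially. \<tau> < v (j k)"
    using j v'_eq u by (intro order_tendstoD) auto
  ultimately have "\<forall>\<^sub>F k in sequentially. False"
  proof eventually_elim
    case (elim k)
    then show ?case using bound[of k] r(3)[of "j k"] by simp
  qed
  then show False by simp
qed

end

section \<open>Dependence of impulsive trajectories on the initial point\<close>

context standing_impulsive_system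
begin

lemma hitting_time_tendsto:
  fixes w :: "nat \<Rightarrow> 'z"
  assumes "w \<longlonglongrightarrow> z" and "z \<in> M \<Longrightarrow> \<exists>\<delta>>0. \<forall>\<^sub>F k in sequentially. ereal \<delta> \<le> hit (w k)"
  shows "(\<lambda>k. hit (w k)) \<longlonglongrightarrow> hit z"
  using hitting_time_lower_semicontinuous[OF assms] hitting_time_upper_semicontinuous[OF M_tube assms(1)]
  by (intro order_tendstoI) auto

lemma hitting_time_dichotomy:
  fixes w :: "nat \<Rightarrow> 'z"
  assumes w: "w \<longlonglongrightarrow> z"
  obtains (continuous) "(\<lambda>k. hit (w k)) \<longlonglongrightarrow> hit z"
  | (vanishing) r where "filterlim r sequentially sequentially" "z \<in> M" "(\<lambda>k. hit (w (r k))) \<longlonglongrightarrow> 0"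
proof (cases "z \<in> M \<longrightarrow> (\<exists>\<delta>>0. \<forall>\<^sub>F k in sequentially. ereal \<delta> \<le> hit (w k))")
  case True
  then show ?thesis using hitting_time_tendsto[OF w] continuous by blast
next
  case False
  have "\<exists>k\<ge>n. hit (w k) < ereal (inverse (real (Suc n)))" for n
  proof -
    have "0 < inverse (real (Suc n))" by simp
    with False have "\<not> (\<forall>\<^sub>F k in sequentially. ereal (inverse (real (Suc n))) \<le> hit (w k))" by blast
    then show ?thesis unfolding eventually_sequentially by (meson not_le)
  qed
  \<comment> \<open>The indices need not increase strictly; \<open>n \<le> r n\<close> is enough for
    them to tend to infinity.\<close>
  then obtain r where r: "\<And>n. n \<le> r n" "\<And>n. hit (w (r n)) < ereal (inverse (real (Suc n)))" by metis
  have "filterlim r sequentially sequentially"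
    by (rule filterlim_at_top_mono[OF filterlim_ident]) (use r in auto)
  moreover have "(\<lambda>k. hit (w (r k))) \<longlonglongrightarrow> 0"
  proof (rule tendsto_sandwich[where f = "\<lambda>_. 0" and h = "\<lambda>n. ereal (inverse (real (Suc n)))"])
    show "(\<lambda>n. ereal (inverse (real (Suc n)))) \<longlonglongrightarrow> 0"
      using LIMSEQ_inverse_real_of_nat by (simp add: zero_ereal_def)
    show "\<forall>\<^sub>F n in sequentially. hit (w (r n)) \<le> ereal (inverse (real (Suc n)))"
      using r(2) by (intro always_eventually) (auto intro: less_imp_le)
    show "\<forall>\<^sub>F n in sequentially. 0 \<le> hit (w (r n))"
      by (intro always_eventually allI less_imp_le hitting_time_pos)
  qed simp
  ultimately show ?thesis using vanishing False by blast
qed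

text \<open>The three limits are proved together, since convergence of the next hitting time drives
  the next impulse. Finiteness of \<open>itime z n\<close> means that the first \<open>n\<close>
  impulses really occur.\<close>

lemma impulses_tendsto:
  fixes w :: "nat \<Rightarrow> 'z"
  assumes w: "w \<longlonglongrightarrow> z" "(\<lambda>k. hit (w k)) \<longlonglongrightarrow> hit z" and n: "itime z n < \<infinity>"
  shows "(\<lambda>k. post (w k) n) \<longlonglongrightarrow> post z n \<and> (\<lambda>k. itime (w k) n) \<longlonglongrightarrow> itime z n \<and>
    (\<lambda>k. hit (post (w k) n)) \<longlonglongrightarrow> hit (post z n)"
  using n
proof (induction n)
  case 0
  then show ?case using w by simp
next
  case (Suc n)
  define P p where "P = post z n" and "p = (\<lambda>k. post (w k) n)"
  have t_fin: "itime z n < \<infinity>" and P_fin: "hit P < \<infinity>"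
    using Suc.prems impulse_time_nonneg[of z n] hitting_time_pos[of P] by (auto simp: P_def)
  have IH: "p \<longlonglongrightarrow> P" "(\<lambda>k. itime (w k) n) \<longlonglongrightarrow> itime z n" "(\<lambda>k. hit (p k)) \<longlonglongrightarrow> hit P"
    using Suc.IH t_fin by (auto simp: P_def p_def)
  have time: "(\<lambda>k. itime (w k) (Suc n)) \<longlonglongrightarrow> itime z (Suc n)"
    using tendsto_add_ereal_general[OF _ IH(2,3)] hitting_time_pos[of P] impulse_time_nonneg[of z n]
    by (auto simp: P_def p_def)
  obtain r where r: "hit P = ereal r" "0 < r" "\<rho> P r \<in> M"
    using P_fin by (cases rule: hitting_time_cases[of P]) auto
  then have P_Suc: "post z (Suc n) = I (\<rho> P r)" by (simp add: P_def)
  define s where "s k = real_of_ereal (hit (p k))" for k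
  have s: "s \<longlonglongrightarrow> r" unfolding s_def using IH(3) r by (intro lim_real_of_ereal) simp
  have "\<forall>\<^sub>F k in sequentially. hit (p k) < \<infinity>"
    using P_fin by (intro order_tendstoD(2)[OF IH(3)])
  then have fin: "\<forall>\<^sub>F k in sequentially. hit (p k) = ereal (s k) \<and> 0 < s k \<and> \<rho> (p k) (s k) \<in> M"
  proof eventually_elim
    case (elim k)
    then show ?case by (cases rule: hitting_time_cases[of "p k"]) (auto simp: s_def)
  qed
  have "(\<lambda>k. \<rho> (p k) (s k)) \<longlonglongrightarrow> \<rho> P r"
    using fin r by (intro tendsto_flow IH s) (auto elim: eventually_mono)
  then have "(\<lambda>k. I (\<rho> (p k) (s k))) \<longlonglongrightarrow> post z (Suc n)"
    unfolding P_Suc using fin r by (intro continuous_on_tendsto_compose[OF I_cont]) (auto elim: eventually_mono)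
  moreover have "\<forall>\<^sub>F k in sequentially. I (\<rho> (p k) (s k)) = post (w k) (Suc n)"
    using fin by eventually_elim (simp add: p_def)
  ultimately have post: "(\<lambda>k. post (w k) (Suc n)) \<longlonglongrightarrow> post z (Suc n)"
    by (rule Lim_transform_eventually)
  \<comment> \<open>After an impulse the point lies in the image of \<open>I\<close>, hence off
    \<open>M\<close>, where the hitting time is continuous. Thus only the initial point needs an
    assumption on hitting times.\<close>
  have "post z (Suc n) \<notin> M" using P_Suc r M_disjoint_image by auto
  then have "(\<lambda>k. hit (post (w k) (Suc n))) \<longlonglongrightarrow> hit (post z (Suc n))"
    by (intro hitting_time_tendsto post) auto
  with post time show ?case by blast
qed

text \<open>Time 0 counts as a non-impulse time: phase 0 starts without an impulse, and at the same
  time for all points.\<close>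

definition non_impulse_time :: "'z \<Rightarrow> real \<Rightarrow> bool" where
  "non_impulse_time z t \<longleftrightarrow> (\<exists>n. phase z t n \<and> (n = 0 \<or> itime z n < ereal t))"

text \<open>Impulse times converge, so \<open>s k\<close> eventually falls into the same phase of
  \<open>w k\<close> as \<open>t\<close> does for \<open>z\<close>. The times vary with
  \<open>k\<close> because the time left after a first impulse does.\<close>

lemma impulsive_traj_tendsto:
  fixes w :: "nat \<Rightarrow> 'z"
  assumes w: "w \<longlonglongrightarrow> z" "(\<lambda>k. hit (w k)) \<longlonglongrightarrow> hit z"
    and s: "s \<longlonglongrightarrow> t" "\<forall>\<^sub>F k in sequentially. 0 \<le> s k"
    and t: "non_impulse_time z t"
  shows "(\<lambda>k. traj (w k) (s k)) \<longlonglongrightarrow> traj z t"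
proof -
  obtain n where n: "phase z t n" "n = 0 \<or> itime z n < ereal t" using t unfolding non_impulse_time_def by blast
  obtain a where a: "itime z n = ereal a" "0 \<le> a" "a \<le> t" "traj z t = \<rho> (post z n) (t - a)"
    using n(1) by (rule impulsive_traj_in_phase)
  have L: "(\<lambda>k. post (w k) n) \<longlonglongrightarrow> post z n" "(\<lambda>k. itime (w k) n) \<longlonglongrightarrow> itime z n"
    "(\<lambda>k. hit (post (w k) n)) \<longlonglongrightarrow> hit (post z n)"
    using impulses_tendsto[OF w, of n] a by auto
  have time: "(\<lambda>k. itime (w k) (Suc n)) \<longlonglongrightarrow> itime z (Suc n)"
    using tendsto_add_ereal_general[OF _ L(2,3)] a(1) by auto
  obtain c where c: "ereal t < c" "c < itime z (Suc n)"
    using n(1) unfolding in_phase_def by (meson dense)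
  have s': "(\<lambda>k. ereal (s k)) \<longlonglongrightarrow> ereal t" using s by simp
  have up: "\<forall>\<^sub>F k in sequentially. ereal (s k) < itime (w k) (Suc n)"
    using order_tendstoD(1)[OF time c(2)] order_tendstoD(2)[OF s' c(1)]
    by eventually_elim (rule less_trans)
  have lo: "\<forall>\<^sub>F k in sequentially. itime (w k) n \<le> ereal (s k)"
  proof (cases "n = 0")
    case True
    then show ?thesis using s(2) by (simp add: zero_ereal_def)
  next
    case False
    then obtain c where c: "itime z n < c" "c < ereal t" using n(2) dense by blast
    show ?thesis
      using order_tendstoD(2)[OF L(2) c(1)] order_tendstoD(1)[OF s' c(2)]
      by eventually_elim simp
  qed
  define b where "b k = real_of_ereal (itime (w k) n)" for k
  have b: "b \<longlonglongrightarrow> a" unfolding b_def using L(2) a(1) by (intro lim_real_of_ereal) simp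
  have eq: "\<forall>\<^sub>F k in sequentially. b k \<le> s k \<and> \<rho> (post (w k) n) (s k - b k) = traj (w k) (s k)"
    using lo up
  proof eventually_elim
    case (elim k)
    then have "phase (w k) (s k) n" by (simp add: in_phase_def)
    then show ?case by (rule impulsive_traj_in_phase) (simp add: b_def)
  qed
  have "(\<lambda>k. \<rho> (post (w k) n) (s k - b k)) \<longlonglongrightarrow> \<rho> (post z n) (t - a)"
    using eq a by (intro tendsto_flow L tendsto_diff s b) (auto elim: eventually_mono)
  then show ?thesis
    using eq a(4) by (auto elim!: Lim_transform_eventually eventually_mono)
qed

lemma impulsive_traj_semigroup:
  "0 \<le> t \<Longrightarrow> 0 \<le> s \<Longrightarrow> traj z (t + s) = traj (traj z t) s"
  using traj_defined impulsive_traj_add unfolding traj_defined_at_def by metis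

text \<open>Phases are half-open: just after \<open>t\<close> the phase is unchanged and its left
  endpoint has been passed.\<close>

lemma
  assumes "0 \<le> t"
  shows eventually_non_impulse_time: "\<forall>\<^sub>F s in at_right t. non_impulse_time z s"
    and impulsive_traj_right_continuous: "(traj z \<longlongrightarrow> traj z t) (at_right t)"
proof -
  obtain n where n: "phase z t n" using traj_defined[OF assms] unfolding traj_defined_at_def by blast
  obtain a where a: "itime z n = ereal a" "0 \<le> a" "a \<le> t" "traj z t = \<rho> (post z n) (t - a)"
    using n by (rule impulsive_traj_in_phase)
  have "((\<lambda>s. ereal s) \<longlongrightarrow> ereal t) (at_right t)" by (intro tendsto_intros)
  then have "\<forall>\<^sub>F s in at_right t. ereal s < itime z (Suc n)"
    using n by (intro order_tendstoD) (auto simp: in_phase_def)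
  moreover have "\<forall>\<^sub>F s in at_right t. t < s" by (simp add: eventually_at_right_less)
  ultimately have ev: "\<forall>\<^sub>F s in at_right t. t < s \<and> phase z s n"
    by eventually_elim (use a in \<open>simp add: in_phase_def\<close>)
  then show "\<forall>\<^sub>F s in at_right t. non_impulse_time z s"
    by (rule eventually_mono) (use a in \<open>auto simp: non_impulse_time_def\<close>)
  have eq: "\<forall>\<^sub>F s in at_right t. a \<le> s \<and> \<rho> (post z n) (s - a) = traj z s"
    using ev
  proof eventually_elim
    case (elim s)
    then have "phase z s n" by simp
    then show ?case by (rule impulsive_traj_in_phase) (use a in simp)
  qed
  have "((\<lambda>s. \<rho> (post z n) (s - a)) \<longlongrightarrow> \<rho> (post z n) (t - a)) (at_right t)"
    using eq a by (intro tendsto_flow tendsto_intros) (auto elim: eventually_mono)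
  then show "(traj z \<longlongrightarrow> traj z t) (at_right t)"
    using eq a(4) by (auto elim!: Lim_transform_eventually eventually_mono)
qed

text \<open>The first impulse comes after a time \<open>r k\<close> tending to 0 and throws
  \<open>w k\<close> to a point near \<open>I z\<close>. As \<open>I z\<close> is not in
  \<open>M\<close>, the trajectories converge from there on, with remaining time
  \<open>t - r k\<close>.\<close>

lemma impulsive_traj_tendsto_vanishing:
  fixes w :: "nat \<Rightarrow> 'z"
  assumes w: "w \<longlonglongrightarrow> z" "(\<lambda>k. hit (w k)) \<longlonglongrightarrow> 0" and z: "z \<in> M"
    and t: "0 < t" "ereal t < hit (I z)"
  shows "(\<lambda>k. traj (w k) t) \<longlonglongrightarrow> traj (I z) t"
proof -
  define r where "r k = real_of_ereal (hit (w k))" for k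
  have r: "r \<longlonglongrightarrow> 0" unfolding r_def using w(2) by (intro lim_real_of_ereal) (simp add: zero_ereal_def)
  have "\<forall>\<^sub>F k in sequentially. hit (w k) < ereal t"
    using t by (intro order_tendstoD(2)[OF w(2)]) simp
  then have fin: "\<forall>\<^sub>F k in sequentially. hit (w k) = ereal (r k) \<and> 0 < r k \<and> r k < t \<and> \<rho> (w k) (r k) \<in> M"
  proof eventually_elim
    case (elim k)
    then show ?case by (cases rule: hitting_time_cases[of "w k"]) (auto simp: r_def)
  qed
  define v where "v k = I (\<rho> (w k) (r k))" for k
  have "(\<lambda>k. \<rho> (w k) (r k)) \<longlonglongrightarrow> \<rho> z 0"
    using fin by (intro tendsto_flow w r) (auto elim: eventually_mono)
  then have v: "v \<longlonglongrightarrow> I z"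
    using fin z at_zero unfolding v_def
    by (intro continuous_on_tendsto_compose[OF I_cont]) (auto elim: eventually_mono)
  have "I z \<notin> M" using z M_disjoint_image by auto
  then have hv: "(\<lambda>k. hit (v k)) \<longlonglongrightarrow> hit (I z)" by (intro hitting_time_tendsto v) auto
  have "non_impulse_time (I z) t"
    using in_phase_0[of t "I z"] t unfolding non_impulse_time_def by (intro exI[of _ 0]) simp
  moreover have "(\<lambda>k. t - r k) \<longlonglongrightarrow> t" using tendsto_diff[OF tendsto_const r, of t] by simp
  ultimately have "(\<lambda>k. traj (v k) (t - r k)) \<longlonglongrightarrow> traj (I z) t"
    using fin by (intro impulsive_traj_tendsto v hv) (auto elim: eventually_mono)
  moreover have "\<forall>\<^sub>F k in sequentially. traj (v k) (t - r k) = traj (w k) t"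
    using fin
  proof eventually_elim
    case (elim k)
    then show ?case
      using impulsive_traj_at_hit[of "w k" "r k"] impulsive_traj_semigroup[of "r k" "t - r k" "w k"]
      by (simp add: v_def)
  qed
  ultimately show ?thesis by (rule Lim_transform_eventually)
qed

text \<open>By the semigroup law, the position at \<open>t k + s\<close> is the position at
  \<open>s\<close> of the trajectory started at \<open>traj z (t k)\<close>.\<close>

lemma limit_seqs_at_shift:
  assumes t: "t \<in> limit_seqs_at \<rho> M I z q" and hit: "(\<lambda>k. hit (traj z (t k))) \<longlonglongrightarrow> hit q"
    and s: "0 \<le> s" "non_impulse_time q s"
  shows "(\<lambda>k. t k + s) \<in> limit_seqs_at \<rho> M I z (traj q s)"
proof -
  have "(\<lambda>k. traj (traj z (t k)) s) \<longlonglongrightarrow> traj q s"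
    using t hit s by (intro impulsive_traj_tendsto) (auto simp: limit_seqs_at_def)
  moreover have "filterlim (\<lambda>k. t k + s) at_top sequentially"
    by (rule filterlim_at_top_mono[of t]) (use t s in \<open>auto simp: limit_seqs_at_def\<close>)
  ultimately show ?thesis
    using t s impulsive_traj_semigroup by (auto simp: limit_seqs_at_def)
qed

end

section \<open>Limit sequences, limit sets and comparability\<close>

lemma filterlim_interleave:
  fixes f g :: "nat \<Rightarrow> 'a"
  assumes "filterlim f F sequentially" "filterlim g F sequentially"
  shows "filterlim (\<lambda>n. if even n then f (n div 2) else g (n div 2)) F sequentially"
proof -
  have half: "filterlim (\<lambda>n::nat. n div 2) sequentially sequentially"
    unfolding filterlim_at_top
  proof
    fix m :: nat
    show "\<forall>\<^sub>F n in sequentially. m \<le> n div 2"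
      using eventually_ge_at_top[of "2 * m"] by eventually_elim auto
  qed
  show ?thesis
    by (intro filterlim_If filterlim_compose[OF assms(1)] filterlim_compose[OF assms(2)]
        filterlim_mono[OF half]) auto
qed

lemma tendsto_if_dist_tendsto_0:
  assumes "((\<lambda>x. dist (f x) (g x)) \<longlongrightarrow> 0) F" "(g \<longlongrightarrow> l) F"
  shows "(f \<longlongrightarrow> l) F"
proof -
  have "((\<lambda>x. dist (f x) (g x) + dist (g x) l) \<longlongrightarrow> 0) F"
    using tendsto_add[OF assms(1) assms(2)[THEN tendsto_dist_iff[THEN iffD1]]] by simp
  then show ?thesis
    unfolding tendsto_dist_iff[of f]
    by (rule tendsto_sandwich[OF _ _ tendsto_const, rotated 2])
      (auto simp: dist_triangle intro: always_eventually)
qed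

lemma limit_set_iff: "q \<in> limit_set \<rho> M I z \<longleftrightarrow> limit_seqs_at \<rho> M I z q \<noteq> {}"
  by (auto simp: limit_set_def limit_seqs_at_def)

lemma limit_seqs_at_subseq:
  assumes "t \<in> limit_seqs_at \<rho> M I z q" "filterlim r sequentially sequentially"
  shows "(\<lambda>k. t (r k)) \<in> limit_seqs_at \<rho> M I z q"
  using assms by (auto simp: limit_seqs_at_def intro: filterlim_compose[of _ _ _ r])

text \<open>For each \<open>k\<close> one late time is chosen at which both approximations are good.
  With \<open>g\<close> the same trajectory this gives closedness of the limit set; with
  \<open>g\<close> the trajectory of the comparable point it gives continuity.\<close>

lemma limit_seqs_at_diagonal:
  assumes t: "\<And>k::nat. t k \<in> limit_seqs_at \<rho> M I z (q k)"
    and g: "\<And>k. (\<lambda>n. g (t k n)) \<longlonglongrightarrow> (p k :: 'b::metric_space)"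
    and q: "q \<longlonglongrightarrow> q'"
  obtains s where "s \<in> limit_seqs_at \<rho> M I z q'" "(\<lambda>k. dist (g (s k)) (p k)) \<longlonglongrightarrow> 0"
proof -
  define e where "e k = inverse (real (Suc k))" for k
  have e: "e \<longlonglongrightarrow> 0" unfolding e_def by (rule LIMSEQ_inverse_real_of_nat)
  have "\<exists>s\<ge>real k. dist (impulsive_traj \<rho> M I z s) (q k) \<le> e k \<and> dist (g s) (p k) \<le> e k" for k
  proof -
    have pos: "0 < e k" by (simp add: e_def)
    have "\<forall>\<^sub>F n in sequentially. real k \<le> t k n"
      "\<forall>\<^sub>F n in sequentially. dist (impulsive_traj \<rho> M I z (t k n)) (q k) < e k"
      "\<forall>\<^sub>F n in sequentially. dist (g (t k n)) (p k) < e k"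
      using t[of k] tendstoD[OF g pos] tendstoD[OF _ pos]
      by (auto simp: limit_seqs_at_def filterlim_at_top)
    then have "\<forall>\<^sub>F n in sequentially. real k \<le> t k n \<and>
        dist (impulsive_traj \<rho> M I z (t k n)) (q k) \<le> e k \<and> dist (g (t k n)) (p k) \<le> e k"
      by eventually_elim auto
    then show ?thesis using eventually_happens trivial_limit_sequentially by blast
  qed
  then obtain s where s: "\<And>k. real k \<le> s k"
    "\<And>k. dist (impulsive_traj \<rho> M I z (s k)) (q k) \<le> e k" "\<And>k. dist (g (s k)) (p k) \<le> e k"
    by metis
  have "(\<lambda>k. dist (impulsive_traj \<rho> M I z (s k)) (q k)) \<longlonglongrightarrow> 0"
    by (rule tendsto_sandwich[OF _ _ tendsto_const e]) (use s in auto)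
  then have "(\<lambda>k. impulsive_traj \<rho> M I z (s k)) \<longlonglongrightarrow> q'"
    using q by (rule tendsto_if_dist_tendsto_0)
  moreover have "filterlim s at_top sequentially"
    by (rule filterlim_at_top_mono[OF filterlim_real_sequentially]) (use s in auto)
  moreover have "0 \<le> s k" for k using s(1)[of k] by linarith
  ultimately have "s \<in> limit_seqs_at \<rho> M I z q'" by (simp add: limit_seqs_at_def)
  moreover have "(\<lambda>k. dist (g (s k)) (p k)) \<longlonglongrightarrow> 0"
    by (rule tendsto_sandwich[OF _ _ tendsto_const e]) (use s in auto)
  ultimately show ?thesis using that by blast
qed

lemma closed_limit_set: "closed (limit_set \<rho> M I z)"
  unfolding closed_sequential_limits
proof safe
  fix q q' assume q: "\<forall>k. q k \<in> limit_set \<rho> M I z" "q \<longlonglongrightarrow> q'"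
  then obtain t where t: "\<And>k. t k \<in> limit_seqs_at \<rho> M I z (q k)" unfolding limit_set_iff ex_in_conv[symmetric] by metis
  have lim: "(\<lambda>n. impulsive_traj \<rho> M I z (t k n)) \<longlonglongrightarrow> q k" for k
    using t[of k] by (simp add: limit_seqs_at_def)
  show "q' \<in> limit_set \<rho> M I z"
    using limit_seqs_at_diagonal[OF t lim q(2)] unfolding limit_set_iff by blast
qed

text \<open>Comparability provides a limit for each sequence separately. Interleaving any sequence
  with a fixed one forces the two limits to agree.\<close>

lemma comparable_limit_seqs_at:
  assumes cmp: "comparable_wrt \<sigma> M\<^sub>Y I\<^sub>Y y \<pi> M\<^sub>X I\<^sub>X x (limit_set \<pi> M\<^sub>X I\<^sub>X x)"
    and q: "q \<in> limit_set \<pi> M\<^sub>X I\<^sub>X x"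
  obtains p where "limit_seqs_at \<pi> M\<^sub>X I\<^sub>X x q \<subseteq> limit_seqs_at \<sigma> M\<^sub>Y I\<^sub>Y y p"
proof -
  have ex: "\<exists>p. t \<in> limit_seqs_at \<sigma> M\<^sub>Y I\<^sub>Y y p" if "t \<in> limit_seqs_at \<pi> M\<^sub>X I\<^sub>X x q" for t
    using cmp that q unfolding comparable_wrt_def limit_seqs_def by blast
  obtain t p where t: "t \<in> limit_seqs_at \<pi> M\<^sub>X I\<^sub>X x q" and p: "t \<in> limit_seqs_at \<sigma> M\<^sub>Y I\<^sub>Y y p"
    using q ex unfolding limit_set_iff by blast
  have "t' \<in> limit_seqs_at \<sigma> M\<^sub>Y I\<^sub>Y y p" if t': "t' \<in> limit_seqs_at \<pi> M\<^sub>X I\<^sub>X x q" for t'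
  proof -
    define u where "u = (\<lambda>n. if even n then t (n div 2) else t' (n div 2))"
    have "(\<lambda>n. impulsive_traj \<pi> M\<^sub>X I\<^sub>X x (u n)) =
        (\<lambda>n. if even n then impulsive_traj \<pi> M\<^sub>X I\<^sub>X x (t (n div 2)) else impulsive_traj \<pi> M\<^sub>X I\<^sub>X x (t' (n div 2)))"
      by (auto simp: u_def)
    then have "u \<in> limit_seqs_at \<pi> M\<^sub>X I\<^sub>X x q"
      using t t' filterlim_interleave[of t at_top t']
        filterlim_interleave[of "\<lambda>n. impulsive_traj \<pi> M\<^sub>X I\<^sub>X x (t n)" "nhds q" "\<lambda>n. impulsive_traj \<pi> M\<^sub>X I\<^sub>X x (t' n)"]
      by (auto simp: limit_seqs_at_def u_def)
    then obtain p' where p': "u \<in> limit_seqs_at \<sigma> M\<^sub>Y I\<^sub>Y y p'" using ex by blast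
    have "filterlim (\<lambda>n::nat. 2 * n) sequentially sequentially" "filterlim (\<lambda>n::nat. Suc (2 * n)) sequentially sequentially"
      by (auto intro!: filterlim_subseq strict_monoI)
    from this[THEN limit_seqs_at_subseq[OF p']]
    have "t \<in> limit_seqs_at \<sigma> M\<^sub>Y I\<^sub>Y y p'" "t' \<in> limit_seqs_at \<sigma> M\<^sub>Y I\<^sub>Y y p'"
      by (auto simp: u_def)
    moreover from this(1) p have "p' = p"
      unfolding limit_seqs_at_def by (auto intro: LIMSEQ_unique)
    ultimately show ?thesis by simp
  qed
  then show ?thesis using that by blast
qed

text \<open>The diagonal sequence \<open>s\<close> converges to \<open>q'\<close> along
  \<open>x\<close>, so along \<open>y\<close> it converges to \<open>h q'\<close>; by construction
  it also stays asymptotic to \<open>h (q k)\<close>.\<close>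

lemma continuous_on_limit_set:
  assumes h: "\<And>q. q \<in> limit_set \<pi> M\<^sub>X I\<^sub>X x \<Longrightarrow>
    limit_seqs_at \<pi> M\<^sub>X I\<^sub>X x q \<subseteq> limit_seqs_at \<sigma> M\<^sub>Y I\<^sub>Y y (h q)"
  shows "continuous_on (limit_set \<pi> M\<^sub>X I\<^sub>X x) h"
  unfolding continuous_on_sequentially
proof safe
  fix q q' assume q: "\<forall>k. q k \<in> limit_set \<pi> M\<^sub>X I\<^sub>X x" "q' \<in> limit_set \<pi> M\<^sub>X I\<^sub>X x" "q \<longlonglongrightarrow> q'"
  then obtain t where t: "\<And>k. t k \<in> limit_seqs_at \<pi> M\<^sub>X I\<^sub>X x (q k)" unfolding limit_set_iff ex_in_conv[symmetric] by metis
  have tY: "(\<lambda>n. impulsive_traj \<sigma> M\<^sub>Y I\<^sub>Y y (t k n)) \<longlonglongrightarrow> h (q k)" for k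
    using h t q(1) unfolding limit_seqs_at_def by blast
  obtain s where s: "s \<in> limit_seqs_at \<pi> M\<^sub>X I\<^sub>X x q'"
    "(\<lambda>k. dist (impulsive_traj \<sigma> M\<^sub>Y I\<^sub>Y y (s k)) (h (q k))) \<longlonglongrightarrow> 0"
    using limit_seqs_at_diagonal[OF t tY q(3)] by blast
  have "(\<lambda>k. impulsive_traj \<sigma> M\<^sub>Y I\<^sub>Y y (s k)) \<longlonglongrightarrow> h q'"
    using s(1) h[OF q(2)] unfolding limit_seqs_at_def by blast
  then show "(h \<circ> q) \<longlonglongrightarrow> h q'"
    unfolding o_def by (rule tendsto_if_dist_tendsto_0[rotated]) (use s(2) in \<open>simp add: dist_commute\<close>)
qed

section \<open>The map between limit sets and the intertwining relation\<close>

theorem corollary4p9: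
  fixes \<pi> :: "'x::metric_space \<Rightarrow> real \<Rightarrow> 'x" and M\<^sub>X :: "'x set" and I\<^sub>X :: "'x \<Rightarrow> 'x"
    and \<sigma> :: "'y::metric_space \<Rightarrow> real \<Rightarrow> 'y" and M\<^sub>Y :: "'y set" and I\<^sub>Y :: "'y \<Rightarrow> 'y"
    and x :: 'x and y :: 'y
  assumes "standing_impulsive_system \<pi> M\<^sub>X I\<^sub>X"
    and "standing_impulsive_system \<sigma> M\<^sub>Y I\<^sub>Y"
    and "limit_set \<pi> M\<^sub>X I\<^sub>X x \<noteq> {}"
    and "comparable_wrt \<sigma> M\<^sub>Y I\<^sub>Y y \<pi> M\<^sub>X I\<^sub>X x (limit_set \<pi> M\<^sub>X I\<^sub>X x)"
  shows "\<exists>h. h \<in> limit_set \<pi> M\<^sub>X I\<^sub>X x \<rightarrow> limit_set \<sigma> M\<^sub>Y I\<^sub>Y y \<and>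
    continuous_on (limit_set \<pi> M\<^sub>X I\<^sub>X x) h \<and>
    (\<forall>q \<in> limit_set \<pi> M\<^sub>X I\<^sub>X x.
       limit_seqs_at \<pi> M\<^sub>X I\<^sub>X x q \<subseteq> limit_seqs_at \<sigma> M\<^sub>Y I\<^sub>Y y (h q)) \<and>
    (\<forall>q \<in> limit_set \<pi> M\<^sub>X I\<^sub>X x - M\<^sub>X. \<forall>t \<ge> 0.
       impulsive_traj \<pi> M\<^sub>X I\<^sub>X q t \<in> limit_set \<pi> M\<^sub>X I\<^sub>X x \<and>
       h (impulsive_traj \<pi> M\<^sub>X I\<^sub>X q t) = impulsive_traj \<sigma> M\<^sub>Y I\<^sub>Y (h q) t)"
proof -
  interpret X: standing_impulsive_system \<pi> M\<^sub>X I\<^sub>X by fact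
  interpret Y: standing_impulsive_system \<sigma> M\<^sub>Y I\<^sub>Y by fact
  define \<Lambda> where "\<Lambda> = limit_set \<pi> M\<^sub>X I\<^sub>X x"
  have "\<forall>q\<in>\<Lambda>. \<exists>p. limit_seqs_at \<pi> M\<^sub>X I\<^sub>X x q \<subseteq> limit_seqs_at \<sigma> M\<^sub>Y I\<^sub>Y y p"
    using comparable_limit_seqs_at[OF assms(4)] unfolding \<Lambda>_def by metis
  from bchoice[OF this] obtain h
    where h: "\<And>q. q \<in> \<Lambda> \<Longrightarrow> limit_seqs_at \<pi> M\<^sub>X I\<^sub>X x q \<subseteq> limit_seqs_at \<sigma> M\<^sub>Y I\<^sub>Y y (h q)"
    by auto
  have hL: "h \<in> \<Lambda> \<rightarrow> limit_set \<sigma> M\<^sub>Y I\<^sub>Y y"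
  proof
    fix q assume q: "q \<in> \<Lambda>"
    then have "limit_seqs_at \<pi> M\<^sub>X I\<^sub>X x q \<noteq> {}" by (simp add: \<Lambda>_def limit_set_iff)
    with h[OF q] show "h q \<in> limit_set \<sigma> M\<^sub>Y I\<^sub>Y y" unfolding limit_set_iff by fast
  qed
  have hcont: "continuous_on \<Lambda> h"
    unfolding \<Lambda>_def by (rule continuous_on_limit_set) (rule h[unfolded \<Lambda>_def])

  have main: "X.traj q t \<in> \<Lambda> \<and> h (X.traj q t) = Y.traj (h q) t"
    if q: "q \<in> \<Lambda>" "q \<notin> M\<^sub>X" and t: "0 \<le> t" for q t
  proof -
    obtain a where a: "a \<in> limit_seqs_at \<pi> M\<^sub>X I\<^sub>X x q" using q(1) unfolding \<Lambda>_def limit_set_iff by blast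
    have aY: "a \<in> limit_seqs_at \<sigma> M\<^sub>Y I\<^sub>Y y (h q)" by (rule subsetD[OF h[OF q(1)] a])
    have hitX: "(\<lambda>k. X.hit (X.traj x (b k))) \<longlonglongrightarrow> X.hit q"
      if "b \<in> limit_seqs_at \<pi> M\<^sub>X I\<^sub>X x q" for b
      using that q(2) by (intro X.hitting_time_tendsto) (auto simp: limit_seqs_at_def)
    \<comment> \<open>Shifting a limit sequence of \<open>q\<close> by \<open>s\<close> gives one of
      \<open>X.traj q s\<close>, so the defining property of \<open>h\<close> also determines the
      limit along \<open>y\<close>.\<close>
    have inL: "X.traj q s \<in> \<Lambda>" and
      limY: "(\<lambda>k. Y.traj y (b k + s)) \<longlonglongrightarrow> h (X.traj q s)"
      if b: "b \<in> limit_seqs_at \<pi> M\<^sub>X I\<^sub>X x q" and s: "0 \<le> s" "X.non_impulse_time q s" for s b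
    proof -
      have sh: "(\<lambda>k. b k + s) \<in> limit_seqs_at \<pi> M\<^sub>X I\<^sub>X x (X.traj q s)"
        by (rule X.limit_seqs_at_shift[OF b hitX[OF b] s])
      then show in\<Lambda>: "X.traj q s \<in> \<Lambda>" unfolding \<Lambda>_def limit_set_iff by blast
      show "(\<lambda>k. Y.traj y (b k + s)) \<longlonglongrightarrow> h (X.traj q s)"
        using subsetD[OF h[OF in\<Lambda>] sh] by (simp add: limit_seqs_at_def)
    qed
    have ev_in: "\<forall>\<^sub>F s in at_right r. X.traj q s \<in> \<Lambda>" if "0 \<le> r" for r
      using X.eventually_non_impulse_time[OF that, of q] eventually_at_right_less[of r]
      by eventually_elim (use inL[OF a] that in auto)
    \<comment> \<open>Impulse times of \<open>q\<close> are reached as limits from the right,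
      because the limit set is closed.\<close>
    have traj_in: "X.traj q r \<in> \<Lambda>" if "0 \<le> r" for r
      unfolding \<Lambda>_def
      by (rule Lim_in_closed_set[OF closed_limit_set ev_in[OF that, unfolded \<Lambda>_def] _
            X.impulsive_traj_right_continuous[OF that]]) simp
    have hright: "((\<lambda>s. h (X.traj q s)) \<longlongrightarrow> h (X.traj q r)) (at_right r)" if "0 \<le> r" for r
      by (rule continuous_on_tendsto_compose[OF hcont X.impulsive_traj_right_continuous[OF that]])
        (use traj_in ev_in that in auto)
    have "\<exists>b \<in> limit_seqs_at \<pi> M\<^sub>X I\<^sub>X x q. (\<lambda>k. Y.hit (Y.traj y (b k))) \<longlonglongrightarrow> Y.hit (h q)"
    proof -
      have wY: "(\<lambda>k. Y.traj y (a k)) \<longlonglongrightarrow> h q" using aY by (simp add: limit_seqs_at_def)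
      show ?thesis
      proof (cases rule: Y.hitting_time_dichotomy[OF wY])
        case 1
        then show ?thesis using a by blast
      next
        case (2 r)
        text \<open>The images of the points just after \<open>q\<close> tend to \<open>h q\<close> and to its impulse, which differ.\<close>
        define b where "b k = a (r k)" for k
        have b: "b \<in> limit_seqs_at \<pi> M\<^sub>X I\<^sub>X x q"
          unfolding b_def by (rule limit_seqs_at_subseq[OF a 2(1)])
        have bY: "b \<in> limit_seqs_at \<sigma> M\<^sub>Y I\<^sub>Y y (h q)" by (rule subsetD[OF h[OF q(1)] b])
        have wbY: "(\<lambda>k. Y.traj y (b k)) \<longlonglongrightarrow> h q" and b0: "\<And>k. 0 \<le> b k"
          using bY by (simp_all add: limit_seqs_at_def)
        \<comment> \<open>Small \<open>s\<close> precede the next impulse of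
          \<open>I\<^sub>Y (h q)\<close>, as required for the limit with vanishing hitting
          times.\<close>
        have "((\<lambda>s. ereal s) \<longlongrightarrow> ereal 0) (at_right 0)" by (intro tendsto_intros)
        then have "\<forall>\<^sub>F s in at_right 0. ereal s < Y.hit (I\<^sub>Y (h q))"
          using Y.hitting_time_pos by (intro order_tendstoD) (auto simp: zero_ereal_def)
        then have "\<forall>\<^sub>F s in at_right 0. h (X.traj q s) = Y.traj (I\<^sub>Y (h q)) s"
          using X.eventually_non_impulse_time[OF order_refl, of q] eventually_at_right_less[of "0::real"]
        proof eventually_elim
          case (elim s)
          have "(\<lambda>k. Y.traj (Y.traj y (b k)) s) \<longlonglongrightarrow> Y.traj (I\<^sub>Y (h q)) s"
            by (rule Y.impulsive_traj_tendsto_vanishing[OF wbY]) (use 2 elim b_def in auto)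
          moreover have "(\<lambda>k. Y.traj (Y.traj y (b k)) s) \<longlonglongrightarrow> h (X.traj q s)"
            using limY[OF b, of s] elim Y.impulsive_traj_semigroup b0 by simp
          ultimately show ?case by (rule LIMSEQ_unique[rotated])
        qed
        then have "((\<lambda>s. h (X.traj q s)) \<longlongrightarrow> Y.traj (I\<^sub>Y (h q)) 0) (at_right 0)"
          using Y.impulsive_traj_right_continuous[of 0 "I\<^sub>Y (h q)"] tendsto_cong by force
        then have "h (X.traj q 0) = Y.traj (I\<^sub>Y (h q)) 0"
          using hright[of 0] by (intro tendsto_unique[of "at_right (0::real)"]) auto
        then have "h q = I\<^sub>Y (h q)"
          using X.impulsive_traj_before_hit[of 0 q] Y.impulsive_traj_before_hit[of 0 "I\<^sub>Y (h q)"]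
            X.hitting_time_pos Y.hitting_time_pos X.at_zero Y.at_zero by (simp add: zero_ereal_def)
        then show ?thesis using 2(2) Y.M_disjoint_image by blast
      qed
    qed
    then obtain b where b: "b \<in> limit_seqs_at \<pi> M\<^sub>X I\<^sub>X x q" "(\<lambda>k. Y.hit (Y.traj y (b k))) \<longlonglongrightarrow> Y.hit (h q)" by blast
    have bY: "b \<in> limit_seqs_at \<sigma> M\<^sub>Y I\<^sub>Y y (h q)" by (rule subsetD[OF h[OF q(1)] b(1)])
    \<comment> \<open>Both sides are limits of \<open>Y.traj y (b k + s)\<close> when
      \<open>s\<close> is an impulse time of neither point. Right continuity then carries the
      equality to \<open>t\<close>, which may itself be an impulse time.\<close>
    have "\<forall>\<^sub>F s in at_right t. h (X.traj q s) = Y.traj (h q) s"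
      using X.eventually_non_impulse_time[OF t, of q] Y.eventually_non_impulse_time[OF t, of "h q"]
        eventually_at_right_less[of t]
    proof eventually_elim
      case (elim s)
      have "(\<lambda>k. Y.traj y (b k + s)) \<longlonglongrightarrow> Y.traj (h q) s"
        using Y.limit_seqs_at_shift[OF bY b(2), of s] elim t by (auto simp: limit_seqs_at_def)
      moreover have "(\<lambda>k. Y.traj y (b k + s)) \<longlonglongrightarrow> h (X.traj q s)"
        using limY[OF b(1), of s] elim t by simp
      ultimately show ?case by (rule LIMSEQ_unique[rotated])
    qed
    then have "((\<lambda>s. h (X.traj q s)) \<longlongrightarrow> Y.traj (h q) t) (at_right t)"
      using Y.impulsive_traj_right_continuous[OF t, of "h q"] tendsto_cong by force
    then have "h (X.traj q t) = Y.traj (h q) t"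
      using hright[OF t] by (intro tendsto_unique[of "at_right t"]) auto
    then show ?thesis using traj_in[OF t] by blast
  qed
  show ?thesis
    using hL hcont h main unfolding \<Lambda>_def by (intro exI[of _ h]) blast
qed

end
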